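(* Let $M_\alpha=\begin{pmatrix}\alpha_{11}&\alpha_{12}\\ \alpha_{21}&\alpha_{22}\end{pmatrix}$ have real entries $\alpha_{ii'}\ge 0$ and $\det M_\alpha\ne 0$, and set $\kappa_1=\frac{\alpha_{22}-\alpha_{12}}{\det M_\alpha}$, $\kappa_2=\frac{\alpha_{11}-\alpha_{21}}{\det M_\alpha}$. Then $\kappa_1\kappa_2<0$ if and only if the influence of one group is centripetal and the influence of the other group is centrifugal. Moreover, if the influence of both groups is centripetal, or the influence of both groups is centrifugal, then $\kappa_1+\kappa_2>0$.
   Context: There are two groups, $1$ and $2$; $\alpha_{ii'}\ge0$ represents how much an element of group $i$ is influenced by an element of group $i'$. For $i\in\{1,2\}$ and $j\ne i$ the other group, the influence of group $i$ is called centripetal if $\alpha_{ii}>\alpha_{ji}$, and centrifugal if $\alpha_{ii}<\alpha_{ji}$. *)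

theory Defs
  imports "HOL-Analysis.Analysis"
begin

text \<open>The two groups are the elements \<open>1\<close> and \<open>2\<close> of the index type \<open>2\<close>; the entry
  \<open>M $ i $ i'\<close> (row \<open>i\<close>, column \<open>i'\<close>) is how much group \<open>i\<close> is influenced by group \<open>i'\<close>.
  For a given \<open>i\<close>, exactly one \<open>j\<close> of this type satisfies \<open>j \<noteq> i\<close>, namely the other group.\<close>

definition centripetal :: "real^2^2 \<Rightarrow> 2 \<Rightarrow> bool" where
  "centripetal M i \<longleftrightarrow> (\<forall>j. j \<noteq> i \<longrightarrow> M $ i $ i > M $ j $ i)"

definition centrifugal :: "real^2^2 \<Rightarrow> 2 \<Rightarrow> bool" where
  "centrifugal M i \<longleftrightarrow> (\<forall>j. j \<noteq> i \<longrightarrow> M $ i $ i < M $ j $ i)"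

definition kappa1 :: "real^2^2 \<Rightarrow> real" where
  "kappa1 M = (M $ 2 $ 2 - M $ 1 $ 2) / det M"

definition kappa2 :: "real^2^2 \<Rightarrow> real" where
  "kappa2 M = (M $ 1 $ 1 - M $ 2 $ 1) / det M"

end

theory Submission
  imports Defs
begin

text \<open>The numerators of \<open>kappa1\<close> and \<open>kappa2\<close> are diagonal minus
  off-diagonal entry in columns 2 and 1, so their signs tell whether groups 2 and 1 are centripetal
  (positive) or centrifugal (negative). In the product the determinant is squared, so only these
  signs matter (\<open>kappa_mult_neg_iff\<close>). If both numerators have the same strict sign,
  nonnegative entries force \<open>det M\<close> to have that sign too, so each kappa is positive,
  and hence their sum.\<close>

lemma exists_2: "(\<exists>i::2. P i) \<longleftrightarrow> P 1 \<or> P 2"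
  using forall_2[of "\<lambda>i. \<not> P i"] by blast

lemma centripetal_2:
  "centripetal M 1 \<longleftrightarrow> M $ 1 $ 1 > M $ 2 $ 1"
  "centripetal M 2 \<longleftrightarrow> M $ 2 $ 2 > M $ 1 $ 2"
  by (simp_all add: centripetal_def forall_2)

lemma centrifugal_2:
  "centrifugal M 1 \<longleftrightarrow> M $ 1 $ 1 < M $ 2 $ 1"
  "centrifugal M 2 \<longleftrightarrow> M $ 2 $ 2 < M $ 1 $ 2"
  by (simp_all add: centrifugal_def forall_2)

lemma kappa_mult_neg_iff:
  assumes "det M \<noteq> 0"
  shows "kappa1 M * kappa2 M < 0 \<longleftrightarrow>
    (\<exists>i j. i \<noteq> j \<and> centripetal M i \<and> centrifugal M j)"
proof -
  have "kappa1 M * kappa2 M = (M$2$2 - M$1$2) * (M$1$1 - M$2$1) / (det M)\<^sup>2"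
    by (simp add: kappa1_def kappa2_def power2_eq_square)
  moreover have "(det M)\<^sup>2 > 0"
    using assms by simp
  ultimately have "kappa1 M * kappa2 M < 0 \<longleftrightarrow> (M$2$2 - M$1$2) * (M$1$1 - M$2$1) < 0"
    by (simp add: divide_less_0_iff)
  \<comment> \<open>A product is negative exactly when its factors have opposite strict signs; the
    two cases are the two ordered pairs of distinct groups.\<close>
  also have "\<dots> \<longleftrightarrow> (\<exists>i j. i \<noteq> j \<and> centripetal M i \<and> centrifugal M j)"
    by (auto simp: mult_less_0_iff exists_2 centripetal_2 centrifugal_2)
  finally show ?thesis .
qed

lemma kappa_pos_if_centripetal:
  assumes "\<And>i i'. M $ i $ i' \<ge> 0" and "\<And>i. centripetal M i"
  shows "kappa1 M > 0" "kappa2 M > 0"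
proof -
  have gt: "M$1$1 > M$2$1" "M$2$2 > M$1$2"
    using assms(2) centripetal_2 by blast+
  \<comment> \<open>Multiplying the column inequalities is valid because the smaller factors, here
    the off-diagonal entries, are nonnegative.\<close>
  have "M$2$1 * M$1$2 < M$1$1 * M$2$2"
    using gt assms(1) by (intro mult_strict_mono') auto
  then have "det M > 0"
    by (simp add: det_2 mult.commute)
  then show "kappa1 M > 0" "kappa2 M > 0"
    using gt by (simp_all add: kappa1_def kappa2_def)
qed

text \<open>Mirror image of the centripetal case: the diagonal entries are now the smaller factors,
  so the determinant and both numerators are negative and the quotients positive.\<close>

lemma kappa_pos_if_centrifugal:
  assumes "\<And>i i'. M $ i $ i' \<ge> 0" and "\<And>i. centrifugal M i"
  shows "kappa1 M > 0" "kappa2 M > 0"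
proof -
  have lt: "M$1$1 < M$2$1" "M$2$2 < M$1$2"
    using assms(2) centrifugal_2 by blast+
  have "M$1$1 * M$2$2 < M$2$1 * M$1$2"
    using lt assms(1) by (intro mult_strict_mono') auto
  then have "det M < 0"
    by (simp add: det_2 mult.commute)
  then show "kappa1 M > 0" "kappa2 M > 0"
    using lt by (simp_all add: kappa1_def kappa2_def divide_neg_neg)
qed

theorem mainTheorem4:
  fixes M :: "real^2^2"
  assumes "\<And>i i'. M $ i $ i' \<ge> 0"
    and "det M \<noteq> 0"
  shows "(kappa1 M * kappa2 M < 0 \<longleftrightarrow>
           (\<exists>i j. i \<noteq> j \<and> centripetal M i \<and> centrifugal M j)) \<and>
         ((\<forall>i. centripetal M i) \<or> (\<forall>i. centrifugal M i) \<longrightarrow> kappa1 M + kappa2 M > 0)"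
proof (intro conjI impI)
  show "kappa1 M * kappa2 M < 0 \<longleftrightarrow>
      (\<exists>i j. i \<noteq> j \<and> centripetal M i \<and> centrifugal M j)"
    using assms(2) by (rule kappa_mult_neg_iff)
next
  assume "(\<forall>i. centripetal M i) \<or> (\<forall>i. centrifugal M i)"
  then show "kappa1 M + kappa2 M > 0"
  proof
    assume "\<forall>i. centripetal M i"
    then show ?thesis
      by (simp add: add_pos_pos kappa_pos_if_centripetal assms(1))
  next
    assume "\<forall>i. centrifugal M i"
    then show ?thesis
      by (simp add: add_pos_pos kappa_pos_if_centrifugal assms(1))
  qed
qed

end
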